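(* Let a finite Markov decision process with state space $\mathcal S$, action space $\mathcal A$, and set of stationary policies $\Pi_F$ be given, and let $\succsim$ be a preorder on the set $\mathcal U$ of all bounded real sequences that satisfies axioms A1, A2, A3, A4 and A5. If a policy $\pi^*\in\Pi_F$ is $\succsim$-optimal within the class of stationary policies, then $\pi^*$ is average overtaking-optimal within the class of stationary policies. That is, if $u(s,\pi^* )\succsim u(s,\pi)$ for every $\pi\in\Pi_F$ and every $s\in\mathcal S$, then $u(s,\pi^* )\succsim_{\mathrm{AO}} u(s,\pi)$ for every $\pi\in\Pi_F$ and every $s\in\mathcal S$.
   Context: **Finite MDP.** $\mathcal S$ (states) and $\mathcal A$ (actions) are finite sets; for each $a\in\mathcal A$ there is a transition probability function $p_a(s'\mid s)$ on $\mathcal S$; and $r:\mathcal S\times\mathcal A\to\mathbb R$ is a reward function. $F$ is the set of all functions $f:\mathcal S\to\mathcal A$. For $f\in F$, $\mathbf Q(f)$ is the transition matrix with entries $\mathbf Q(f)_{s,s'}=p_{f(s)}(s'\mid s)$ and $\mathbf r(f)$ is the reward vector with entries $\mathbf r(f)_s=r(s,f(s))$. A policy is a sequence $\pi=(f_1,f_2,f_3,\dots)$ in $F$; it is stationary if it has the form $(f,f,f,\dots)$ for some $f\in F$. $\Pi_F$ is the set of stationary policies. For an initial state $s\in\mathcal S$ and a policy $\pi=(f_1,f_2,\dots)$, the generated stream $u(s,\pi)=(u_1,u_2,\dots)$ of expected rewards is $u_1=[\mathbf r(f_1)]_s$ and $u_t=[\mathbf Q(f_1)\cdots\mathbf Q(f_{t-1})\,\mathbf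 r(f_t)]_s$ for $t\ge 2$. **Preferences.** $\mathcal U$ is the set of all bounded real sequences $u=(u_1,u_2,\dots)$. A preorder is a reflexive and transitive (not necessarily complete) binary relation $\succsim$. Write $u\succ v$ if $u\succsim v$ and not $v\succsim u$; write $u\sim v$ if $u\succsim v$ and $v\succsim u$. For $c\in\mathbb R$, $(c,u)=(c,u_1,u_2,\dots)$. For $n\ge1$, $u_{[n]}$ is obtained from $u$ by replacing $u_t$ with $0$ for all $t>n$. **Axioms.** - A1: for all $u,v\in\mathcal U$, if $u_t\ge v_t$ for all $t$ and $u_t>v_t$ for some $t$, then $u\succ v$. - A2: for all $u,v\in\mathcal U$, if $u$ can be obtained from $v$ by interchanging two entries of $v$, then $u\sim v$. - A3: for all $u,v\in\mathcal U$, if there exists $N>1$ such that $u_{[n]}\succ v_{[n]}$ for all $n\ge N$, then $u\succsim v$. - A4: for all $u,v\in\mathcal U$ and $c\in\mathbb R$, $(c,u)\succsim(c,v)$ if and only if $u\succsim v$. - A5: for all $u,v,\alpha\in\mathcal U$, if $u\succsim v$, then $u+\alpha\succsim v+\alpha$. **Average overtaking preorder.** With $\sigma_T(w)=\sum_{t=1}^T w_t$, $u\succsim_{\mathrm{AO}}v$ if and only if $\liminf_{T\to\infty}\frac1T\sum_{t=1}^T\sigma_t(u-v)\ge 0$. *)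

theory Defs
  imports "HOL-Probability.Probability"
begin

text \<open>
  Streams are indexed from 0: the entry \<open>u t\<close> is the entry at time \<open>t + 1\<close> in the usual
  numbering \<open>u\<^sub>1, u\<^sub>2, \<dots>\<close>. The same holds for policies.
\<close>

type_synonym real_seq = "nat \<Rightarrow> real"
type_synonym pref = "real_seq \<Rightarrow> real_seq \<Rightarrow> bool"
type_synonym ('s, 'a) policy = "nat \<Rightarrow> 's \<Rightarrow> 'a"

text \<open>Here \<open>pmf (p a s) s'\<close> is the transition probability \<open>p\<^sub>a(s' | s)\<close>.\<close>

definition Q_mat :: "('a::finite \<Rightarrow> 's::finite \<Rightarrow> 's pmf) \<Rightarrow> ('s \<Rightarrow> 'a) \<Rightarrow> real^'s^'s" where
  "Q_mat p f = (\<chi> s s'. pmf (p (f s) s) s')"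

definition r_vec :: "('s::finite \<times> 'a::finite \<Rightarrow> real) \<Rightarrow> ('s \<Rightarrow> 'a) \<Rightarrow> real^'s" where
  "r_vec r f = (\<chi> s. r (s, f s))"

primrec Q_prod :: "('a::finite \<Rightarrow> 's::finite \<Rightarrow> 's pmf) \<Rightarrow> ('s, 'a) policy \<Rightarrow> nat \<Rightarrow> real^'s^'s" where
  "Q_prod p \<pi> 0 = mat 1"
| "Q_prod p \<pi> (Suc t) = Q_prod p \<pi> t ** Q_mat p (\<pi> t)"

definition reward_stream ::
  "('a::finite \<Rightarrow> 's::finite \<Rightarrow> 's pmf) \<Rightarrow> ('s \<times> 'a \<Rightarrow> real) \<Rightarrow> 's \<Rightarrow> ('s, 'a) policy \<Rightarrow> real_seq" where
  "reward_stream p r s \<pi> = (\<lambda>t. (Q_prod p \<pi> t *v r_vec r (\<pi> t)) $ s)"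

definition stationary_policies :: "('s, 'a) policy set" where
  "stationary_policies = {\<pi>. \<exists>f. \<pi> = (\<lambda>_. f)}"

definition stationary_optimal ::
  "pref \<Rightarrow> ('a::finite \<Rightarrow> 's::finite \<Rightarrow> 's pmf) \<Rightarrow> ('s \<times> 'a \<Rightarrow> real) \<Rightarrow> ('s, 'a) policy \<Rightarrow> bool" where
  "stationary_optimal R p r \<pi>' \<longleftrightarrow>
     \<pi>' \<in> stationary_policies \<and>
     (\<forall>\<pi>\<in>stationary_policies. \<forall>s. R (reward_stream p r s \<pi>') (reward_stream p r s \<pi>))"

definition bounded_streams :: "real_seq set" where
  "bounded_streams = {u. bounded (range u)}"

text \<open>Only the restriction of a relation to \<^const>\<open>bounded_streams\<close> is constrained below.\<close>

definition preorder_on_streams :: "pref \<Rightarrow> bool" where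
  "preorder_on_streams R \<longleftrightarrow> reflp_on bounded_streams R \<and> transp_on bounded_streams R"

definition strict_pref :: "pref \<Rightarrow> pref" where
  "strict_pref R u v \<longleftrightarrow> R u v \<and> \<not> R v u"

definition indiff :: "pref \<Rightarrow> pref" where
  "indiff R u v \<longleftrightarrow> R u v \<and> R v u"

definition truncate_stream :: "nat \<Rightarrow> real_seq \<Rightarrow> real_seq" where
  "truncate_stream n u = (\<lambda>t. if t < n then u t else 0)"

definition axiom_A1 :: "pref \<Rightarrow> bool" where
  "axiom_A1 R \<longleftrightarrow> (\<forall>u\<in>bounded_streams. \<forall>v\<in>bounded_streams.
     (\<forall>t. u t \<ge> v t) \<and> (\<exists>t. u t > v t) \<longrightarrow> strict_pref R u v)"

definition axiom_A2 :: "pref \<Rightarrow> bool" where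
  "axiom_A2 R \<longleftrightarrow> (\<forall>u\<in>bounded_streams. \<forall>v\<in>bounded_streams.
     (\<exists>i j. i \<noteq> j \<and> u = v(i := v j, j := v i)) \<longrightarrow> indiff R u v)"

definition axiom_A3 :: "pref \<Rightarrow> bool" where
  "axiom_A3 R \<longleftrightarrow> (\<forall>u\<in>bounded_streams. \<forall>v\<in>bounded_streams.
     (\<exists>N>1. \<forall>n\<ge>N. strict_pref R (truncate_stream n u) (truncate_stream n v)) \<longrightarrow> R u v)"

definition axiom_A4 :: "pref \<Rightarrow> bool" where
  "axiom_A4 R \<longleftrightarrow> (\<forall>u\<in>bounded_streams. \<forall>v\<in>bounded_streams. \<forall>c.
     R (case_nat c u) (case_nat c v) \<longleftrightarrow> R u v)"

definition axiom_A5 :: "pref \<Rightarrow> bool" where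
  "axiom_A5 R \<longleftrightarrow> (\<forall>u\<in>bounded_streams. \<forall>v\<in>bounded_streams. \<forall>\<alpha>\<in>bounded_streams.
     R u v \<longrightarrow> R (\<lambda>t. u t + \<alpha> t) (\<lambda>t. v t + \<alpha> t))"

definition partial_sum :: "real_seq \<Rightarrow> nat \<Rightarrow> real" where
  "partial_sum w T = (\<Sum>t<T. w t)"

text \<open>The averages may be unbounded even for bounded streams, so the limit inferior is extended-real.\<close>

definition avg_overtaking :: pref where
  "avg_overtaking u v \<longleftrightarrow>
     liminf (\<lambda>T. ereal (1 / real T * (\<Sum>t=1..T. partial_sum (\<lambda>k. u k - v k) t))) \<ge> 0"

end

theory Submission
  imports Defs
begin

text \<open>
  Let \<open>Q\<close> be a stochastic matrix. Its powers are bounded, so \<open>ker (I - Q)\<close> and \<open>im (I - Q)\<close> are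
  complementary and every vector has the form \<open>g + (h - Q h)\<close> with \<open>Q g = g\<close> and \<open>h = k - Q k\<close>.
  Hence the partial sums of a stationary reward stream are \<open>n g + h - Q\<^sup>n h\<close>, where the sum of
  \<open>Q\<^sup>n h\<close> over any window of consecutive \<open>n\<close> telescopes and is bounded independently of the window.
  The Cesaro averages of the partial sums of the difference \<open>z\<close> of two such streams therefore behave
  like those of \<open>\<gamma> n + \<eta>\<close>.

  If the liminf of these averages were negative, then \<open>\<gamma> < 0\<close>, or \<open>\<gamma> = 0\<close> and \<open>\<eta> < 0\<close>, and the sum
  of sufficiently many delayed copies of \<open>z\<close> would have partial sums that are eventually negative and
  bounded away from 0. By A1, A2, A3 and A5 such a sum is not weakly preferred to the null stream,
  whereas by A4 and A5 it inherits this weak preference from \<open>z\<close>.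
\<close>

section \<open>Bounded streams\<close>

lemma bounded_streamsI: "(\<And>t. \<bar>u t\<bar> \<le> B) \<Longrightarrow> u \<in> bounded_streams"
  by (auto simp: bounded_streams_def bounded_iff)

lemma bounded_streamsE:
  assumes "u \<in> bounded_streams"
  obtains B where "\<And>t. \<bar>u t\<bar> \<le> B"
  using assms by (auto simp: bounded_streams_def bounded_iff)

lemma bounded_streams_add:
  assumes "u \<in> bounded_streams" "v \<in> bounded_streams"
  shows "(\<lambda>t. u t + v t) \<in> bounded_streams"
proof -
  obtain B C where "\<And>t. \<bar>u t\<bar> \<le> B" "\<And>t. \<bar>v t\<bar> \<le> C"
    using assms by (meson bounded_streamsE)
  then show ?thesis
    by (intro bounded_streamsI[of _ "B + C"]) (meson abs_triangle_ineq add_mono order_trans)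
qed

lemma bounded_streams_uminus: "u \<in> bounded_streams \<Longrightarrow> (\<lambda>t. - u t) \<in> bounded_streams"
  by (auto simp: bounded_streams_def bounded_iff)

lemma bounded_streams_diff:
  assumes "u \<in> bounded_streams" "v \<in> bounded_streams"
  shows "(\<lambda>t. u t - v t) \<in> bounded_streams"
  using bounded_streams_add[OF assms(1) bounded_streams_uminus[OF assms(2)]] by simp

lemma bounded_streams_zero: "(\<lambda>_. 0) \<in> bounded_streams"
  by (rule bounded_streamsI[of _ 0]) simp

lemma bounded_streams_truncate: "truncate_stream n u \<in> bounded_streams"
proof (rule bounded_streamsI)
  show "\<bar>truncate_stream n u t\<bar> \<le> (\<Sum>i<n. \<bar>u i\<bar>)" for t
    by (auto simp: truncate_stream_def intro!: sum_nonneg member_le_sum)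
qed

definition single_stream :: "nat \<Rightarrow> real \<Rightarrow> real_seq" where
  "single_stream i d = (\<lambda>t. if t = i then d else 0)"

lemma bounded_streams_single: "single_stream i d \<in> bounded_streams"
  by (rule bounded_streamsI[of _ "\<bar>d\<bar>"]) (auto simp: single_stream_def)

lemma partial_sum_single_0: "n > 0 \<Longrightarrow> partial_sum (single_stream 0 d) n = d"
  by (simp add: partial_sum_def single_stream_def)

definition delay :: "nat \<Rightarrow> real_seq \<Rightarrow> real_seq" where
  "delay k u = (\<lambda>t. if t < k then 0 else u (t - k))"

lemma delay_0: "delay 0 u = u"
  by (simp add: delay_def)

lemma delay_Suc: "delay (Suc k) u = case_nat 0 (delay k u)"
  by (auto simp: delay_def fun_eq_iff split: nat.split)

lemma bounded_streams_delay: "u \<in> bounded_streams \<Longrightarrow> delay k u \<in> bounded_streams"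
proof -
  assume "u \<in> bounded_streams"
  then obtain B where B: "\<And>t. \<bar>u t\<bar> \<le> B" by (meson bounded_streamsE)
  then show ?thesis
    by (intro bounded_streamsI[of _ B]) (auto simp: delay_def intro: order_trans[OF abs_ge_zero])
qed

text \<open>Truncated subtraction covers \<open>n < k\<close>: the partial sum of length 0 is then
  0, as only padding zeros have been added up.\<close>

lemma partial_sum_delay: "partial_sum (delay k u) n = partial_sum u (n - k)"
proof (induction n)
  case (Suc n)
  then show ?case
    by (cases "n < k") (auto simp: partial_sum_def delay_def Suc_diff_le)
qed (simp add: partial_sum_def)

section \<open>Preferences satisfying the axioms\<close>

locale stream_preference =
  fixes R :: pref
  assumes preorder: "preorder_on_streams R"
    and A1: "axiom_A1 R" and A2: "axiom_A2 R" and A3: "axiom_A3 R"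
    and A4: "axiom_A4 R" and A5: "axiom_A5 R"
begin

text \<open>By A5 a comparison of two streams depends only on their difference. The streams
  collected here are closed under addition and delay, which turns the axioms into
  arithmetic.\<close>

definition weakly_good :: "real_seq \<Rightarrow> bool" where
  "weakly_good w \<longleftrightarrow> w \<in> bounded_streams \<and> R w (\<lambda>_. 0)"

lemma bounded: "weakly_good w \<Longrightarrow> w \<in> bounded_streams"
  by (simp add: weakly_good_def)

lemma R_trans:
  "R u v \<Longrightarrow> R v w \<Longrightarrow> u \<in> bounded_streams \<Longrightarrow> v \<in> bounded_streams \<Longrightarrow> w \<in> bounded_streams \<Longrightarrow> R u w"
  using preorder unfolding preorder_on_streams_def by (metis transp_onD)

lemma R_add:
  "R u v \<Longrightarrow> u \<in> bounded_streams \<Longrightarrow> v \<in> bounded_streams \<Longrightarrow> a \<in> bounded_streams \<Longrightarrow>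
    R (\<lambda>t. u t + a t) (\<lambda>t. v t + a t)"
  using A5 unfolding axiom_A5_def by blast

lemma R_imp_weakly_good:
  assumes "R u v" "u \<in> bounded_streams" "v \<in> bounded_streams"
  shows "weakly_good (\<lambda>t. u t - v t)"
  using R_add[OF assms bounded_streams_uminus[OF assms(3)]] bounded_streams_diff[OF assms(2,3)]
  by (simp add: weakly_good_def)

lemma weakly_good_zero: "weakly_good (\<lambda>_. 0)"
  using preorder bounded_streams_zero
  by (auto simp: weakly_good_def preorder_on_streams_def dest: reflp_onD)

lemma weakly_good_add:
  assumes "weakly_good u" "weakly_good v"
  shows "weakly_good (\<lambda>t. u t + v t)"
proof -
  have "R (\<lambda>t. u t + v t) (\<lambda>t. 0 + v t)"
    using assms by (intro R_add) (auto simp: weakly_good_def bounded_streams_zero)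
  then show ?thesis
    using assms R_trans[of "\<lambda>t. u t + v t" v "\<lambda>_. 0"]
    by (auto simp: weakly_good_def bounded_streams_zero bounded_streams_add)
qed

lemma weakly_good_sum:
  assumes "finite A" "\<And>k. k \<in> A \<Longrightarrow> weakly_good (f k)"
  shows "weakly_good (\<lambda>t. \<Sum>k\<in>A. f k t)"
  using assms by (induction A) (auto simp: weakly_good_zero intro!: weakly_good_add)

text \<open>Each unit of delay is one use of A4 with \<open>c = 0\<close>, and prepending 0 leaves
  the null stream unchanged.\<close>

lemma weakly_good_delay: "weakly_good w \<Longrightarrow> weakly_good (delay k w)"
proof (induction k)
  case (Suc k)
  have "R (case_nat 0 (delay k w)) (case_nat 0 (\<lambda>_. 0))"
    using A4 Suc by (auto simp: axiom_A4_def weakly_good_def bounded_streams_zero)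
  moreover have "case_nat 0 (\<lambda>_. 0) = (\<lambda>_. 0 :: real)"
    by (auto simp: fun_eq_iff split: nat.split)
  ultimately show ?case
    using Suc.prems bounded_streams_delay[of w "Suc k"] by (simp add: weakly_good_def delay_Suc)
qed (simp add: delay_0)

lemma single_0_good: "d > 0 \<Longrightarrow> weakly_good (single_stream 0 d)"
  and single_0_not_good: "d > 0 \<Longrightarrow> \<not> weakly_good (single_stream 0 (- d))"
proof -
  assume d: "d > 0"
  have "strict_pref R (single_stream 0 d) (\<lambda>_. 0)"
    using A1 d bounded_streams_single bounded_streams_zero
    unfolding axiom_A1_def by (auto simp: single_stream_def)
  then show "weakly_good (single_stream 0 d)"
    by (simp add: weakly_good_def strict_pref_def bounded_streams_single)
  have "strict_pref R (\<lambda>_. 0) (single_stream 0 (- d))"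
    using A1 d bounded_streams_single bounded_streams_zero
    unfolding axiom_A1_def by (auto simp: single_stream_def)
  then show "\<not> weakly_good (single_stream 0 (- d))"
    by (simp add: weakly_good_def strict_pref_def)
qed

text \<open>The two single-entry streams differ by an interchange, so A2 makes them indifferent. The
  sign of \<open>d\<close> is arbitrary.\<close>

lemma transfer_good: "weakly_good (\<lambda>t. single_stream i d t - single_stream j d t)"
proof (cases "i = j")
  case False
  have "single_stream i d = (single_stream j d)(i := single_stream j d j, j := single_stream j d i)"
    using False by (auto simp: single_stream_def)
  then have "indiff R (single_stream i d) (single_stream j d)"
    using A2 False bounded_streams_single unfolding axiom_A2_def by blast
  then show ?thesis
    by (intro R_imp_weakly_good bounded_streams_single) (simp add: indiff_def)
qed (simp add: weakly_good_zero)

text \<open>Finitely many transfers collect the first \<open>n\<close> entries at index 0, one entry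
  per induction step.\<close>

lemma truncate_minus_total_good:
  "weakly_good (\<lambda>t. truncate_stream n w t - single_stream 0 (partial_sum w n) t)"
proof (induction n)
  case 0
  then show ?case
    by (simp add: truncate_stream_def single_stream_def partial_sum_def weakly_good_zero)
next
  case (Suc n)
  have "(\<lambda>t. truncate_stream (Suc n) w t - single_stream 0 (partial_sum w (Suc n)) t) =
     (\<lambda>t. (truncate_stream n w t - single_stream 0 (partial_sum w n) t)
        + (single_stream n (w n) t - single_stream 0 (w n) t))"
    by (auto simp: truncate_stream_def single_stream_def partial_sum_def fun_eq_iff)
  then show ?case
    using weakly_good_add[OF Suc transfer_good] by simp
qed

text \<open>Once the total sits at index 0, A1 settles the comparison with the null stream.\<close>

lemma truncate_strict_pref:
  assumes "partial_sum w n > 0"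
  shows "strict_pref R (truncate_stream n w) (\<lambda>_. 0)"
proof -
  have "weakly_good (\<lambda>t. (truncate_stream n w t - single_stream 0 (partial_sum w n) t)
      + single_stream 0 (partial_sum w n) t)"
    using assms by (intro weakly_good_add truncate_minus_total_good single_0_good)
  then have "R (truncate_stream n w) (\<lambda>_. 0)"
    by (simp add: weakly_good_def)
  moreover have "\<not> R (\<lambda>_. 0) (truncate_stream n w)"
  proof
    assume "R (\<lambda>_. 0) (truncate_stream n w)"
    then have "weakly_good (\<lambda>t. 0 - truncate_stream n w t)"
      by (intro R_imp_weakly_good bounded_streams_zero bounded_streams_truncate)
    \<comment> \<open>The truncated stream cancels, and a negative entry at index 0 remains, against
      A1.\<close>
    from weakly_good_add[OF truncate_minus_total_good[of n w] this]
    have "weakly_good (single_stream 0 (- partial_sum w n))"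
      by (simp add: single_stream_def if_distrib[of uminus] cong: if_cong)
    then show False
      using single_0_not_good assms by blast
  qed
  ultimately show ?thesis
    by (simp add: strict_pref_def)
qed

lemma weakly_good_if_partial_sums_pos:
  assumes "w \<in> bounded_streams" "\<And>n. n \<ge> N \<Longrightarrow> partial_sum w n > 0"
  shows "weakly_good w"
proof -
  have "\<exists>N>1. \<forall>n\<ge>N. strict_pref R (truncate_stream n w) (truncate_stream n (\<lambda>_. 0))"
    using assms(2) truncate_strict_pref
    by (intro exI[of _ "N + 2"]) (auto simp: truncate_stream_def[of _ "\<lambda>_. 0"] cong: if_cong)
  then show ?thesis
    using A3 assms(1) bounded_streams_zero unfolding axiom_A3_def weakly_good_def by blast
qed

text \<open>A3 concludes only a weak preference. The uniform gap \<open>e\<close> allows a small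
  amount to be taken from \<open>- w\<close> before A3 is applied, and that amount contradicts A1
  when \<open>w\<close> is added back.\<close>

lemma not_good_if_partial_sums_neg:
  assumes "e > 0" "\<And>n. n \<ge> N \<Longrightarrow> partial_sum w n \<le> - e"
  shows "\<not> weakly_good w"
proof
  assume w: "weakly_good w"
  define v where "v = (\<lambda>t. - w t - single_stream 0 (e / 2) t)"
  have "weakly_good v"
  proof (rule weakly_good_if_partial_sums_pos)
    show "v \<in> bounded_streams"
      unfolding v_def
      by (intro bounded_streams_diff bounded_streams_uminus bounded_streams_single bounded w)
    \<comment> \<open>The bound \<open>N + 1\<close> forces \<open>n > 0\<close>, so that the entry
      \<open>e / 2\<close> at index 0 is counted.\<close>
    show "partial_sum v n > 0" if "n \<ge> N + 1" for n
    proof -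
      have "partial_sum v n = - partial_sum w n - partial_sum (single_stream 0 (e / 2)) n"
        by (simp add: partial_sum_def v_def sum_subtractf sum_negf)
      then show ?thesis
        using assms(1) assms(2)[of n] that partial_sum_single_0[of n "e / 2"] by simp
    qed
  qed
  from weakly_good_add[OF w this] have "weakly_good (single_stream 0 (- (e / 2)))"
    by (simp add: v_def single_stream_def if_distrib[of uminus] cong: if_cong)
  then show False
    using single_0_not_good[of "e / 2"] assms(1) by simp
qed

text \<open>A window sum of partial sums is itself a partial sum, namely that of the sum of
  \<open>m\<close> delayed copies of \<open>w\<close>.\<close>

lemma not_good_if_windows_neg:
  assumes "e > 0" "\<And>n. n \<ge> N \<Longrightarrow> (\<Sum>k<m. partial_sum w (n - k)) \<le> - e"
  shows "\<not> weakly_good w"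
proof
  assume w: "weakly_good w"
  define W where "W = (\<lambda>t. \<Sum>k<m. delay k w t)"
  have "weakly_good W"
    unfolding W_def by (intro weakly_good_sum weakly_good_delay w) simp
  moreover have "partial_sum W n = (\<Sum>k<m. partial_sum w (n - k))" for n
    unfolding partial_sum_delay[of _ w n, symmetric] unfolding W_def partial_sum_def by (rule sum.swap)
  ultimately show False
    using not_good_if_partial_sums_neg[of e N W] assms by simp
qed

end

section \<open>Streams with asymptotically affine partial sums\<close>

text \<open>The window consists of the \<open>m\<close> indices ending at \<open>n\<close>;
  \<open>m \<le> Suc n\<close> keeps \<open>n - k\<close> from being truncated. The bound is uniform
  in position and length: short windows serve the delayed copies, the window from 1 to
  \<open>T\<close> the averages.\<close>

definition windows_bounded :: "real_seq \<Rightarrow> bool" where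
  "windows_bounded y \<longleftrightarrow> (\<exists>C. \<forall>n m. m \<le> Suc n \<longrightarrow> \<bar>\<Sum>k<m. y (n - k)\<bar> \<le> C)"

text \<open>For the partial sums of a stationary reward stream, \<open>\<gamma>\<close> is the gain
  and \<open>\<eta>\<close> the bias at the initial state. The deviation need not converge, as
  periodic chains show.\<close>

definition asymptotically_affine :: "real \<Rightarrow> real \<Rightarrow> real_seq \<Rightarrow> bool" where
  "asymptotically_affine \<gamma> \<eta> x \<longleftrightarrow> windows_bounded (\<lambda>n. x n - (\<gamma> * real n + \<eta>))"

lemma windows_bounded_diff:
  assumes "windows_bounded x" "windows_bounded y"
  shows "windows_bounded (\<lambda>n. x n - y n)"
proof -
  obtain B C where "\<And>n m. m \<le> Suc n \<Longrightarrow> \<bar>\<Sum>k<m. x (n - k)\<bar> \<le> B"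
    "\<And>n m. m \<le> Suc n \<Longrightarrow> \<bar>\<Sum>k<m. y (n - k)\<bar> \<le> C"
    using assms unfolding windows_bounded_def by blast
  then show ?thesis
    unfolding windows_bounded_def sum_subtractf
    by (intro exI[of _ "B + C"]) (meson abs_triangle_ineq4 add_mono order_trans)
qed

lemma asymptotically_affine_diff:
  assumes "asymptotically_affine a b x" "asymptotically_affine c d y"
  shows "asymptotically_affine (a - c) (b - d) (\<lambda>n. x n - y n)"
  using windows_bounded_diff[OF assms[unfolded asymptotically_affine_def]]
  by (simp add: asymptotically_affine_def algebra_simps)

lemma asymptotically_affineE:
  assumes "asymptotically_affine \<gamma> \<eta> x"
  obtains C where "\<And>n m. m \<le> Suc n \<Longrightarrow>
    \<bar>(\<Sum>k<m. x (n - k)) - (\<Sum>k<m. \<gamma> * real (n - k) + \<eta>)\<bar> \<le> C"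
  using assms unfolding asymptotically_affine_def windows_bounded_def sum_subtractf by blast

lemma (in stream_preference) weakly_good_affine_limit:
  assumes "weakly_good w" "asymptotically_affine \<gamma> \<eta> (partial_sum w)"
  shows "\<gamma> > 0 \<or> \<gamma> = 0 \<and> \<eta> \<ge> 0"
proof (rule ccontr)
  assume neg: "\<not> ?thesis"
  obtain C where C: "\<And>n m. m \<le> Suc n \<Longrightarrow>
    \<bar>(\<Sum>k<m. partial_sum w (n - k)) - (\<Sum>k<m. \<gamma> * real (n - k) + \<eta>)\<bar> \<le> C"
    using assms(2) by (rule asymptotically_affineE) blast
  show False
  proof (cases "\<gamma> = 0")
    case True
    then have "\<eta> < 0" using neg by simp
    \<comment> \<open>A window of length \<open>m\<close> sums to \<open>m * \<eta>\<close> up to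
      \<open>C\<close>. Since \<open>C\<close> does not depend on \<open>m\<close>, a long window
      pushes the sum below -1.\<close>
    then obtain m :: nat where m: "real m * (- \<eta>) > C + 1"
      using reals_Archimedean3[of "- \<eta>"] by auto
    have "(\<Sum>k<m. partial_sum w (n - k)) \<le> - 1" if "n \<ge> m" for n
      using C[of m n] that m True by (simp add: abs_le_iff)
    then show False
      using not_good_if_windows_neg[of 1 m w m] assms(1) by auto
  next
    case False
    then have "\<gamma> < 0" using neg by simp
    \<comment> \<open>Here windows of length 1 suffice: \<open>\<gamma> * n + \<eta>\<close> lies
      below \<open>- C - 1\<close> from \<open>N\<close> on.\<close>
    then obtain N :: nat where N: "real N * (- \<gamma>) > C + 1 + \<eta>"
      using reals_Archimedean3[of "- \<gamma>"] by auto
    have "(\<Sum>k<1. partial_sum w (n - k)) \<le> - 1" if "n \<ge> N" for n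
    proof -
      have "real n * (- \<gamma>) \<ge> real N * (- \<gamma>)"
        using that \<open>\<gamma> < 0\<close> by (intro mult_right_mono) auto
      then show ?thesis
        using C[of 1 n] N by (simp add: abs_le_iff mult.commute)
    qed
    then show False
      using not_good_if_windows_neg[of 1 N w 1] assms(1) by auto
  qed
qed

text \<open>The affine part of the sum over 1 to \<open>T\<close> is eventually nonnegative, so the
  averages are at least \<open>- C / T\<close>, which tends to 0.\<close>

lemma liminf_averages_nonneg:
  assumes x: "asymptotically_affine \<gamma> \<eta> x" and pos: "\<gamma> > 0 \<or> \<gamma> = 0 \<and> \<eta> \<ge> 0"
  shows "liminf (\<lambda>T. ereal (1 / real T * (\<Sum>t=1..T. x t))) \<ge> 0"
proof -
  obtain C where C: "\<And>n m. m \<le> Suc n \<Longrightarrow>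
    \<bar>(\<Sum>k<m. x (n - k)) - (\<Sum>k<m. \<gamma> * real (n - k) + \<eta>)\<bar> \<le> C"
    using x by (rule asymptotically_affineE) blast
  have affine: "(\<Sum>k<T. \<gamma> * real (T - k) + \<eta>) = real T * (\<gamma> * (real T + 1) / 2 + \<eta>)" for T
  proof -
    have "(\<Sum>k<T. real (T - k)) = (\<Sum>k<T. real (Suc k))"
      using sum.nat_diff_reindex[of "\<lambda>k. real (Suc k)" T] by (simp add: Suc_diff_Suc)
    also have "\<dots> = real T * (real T + 1) / 2"
      by (induction T) (auto simp: field_simps)
    finally show ?thesis
      by (simp only: sum.distrib sum_distrib_left[symmetric]) (simp add: algebra_simps)
  qed
  have "eventually (\<lambda>T. \<gamma> * (real T + 1) / 2 + \<eta> \<ge> 0) sequentially"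
  proof (cases "\<gamma> > 0")
    case True
    then obtain N :: nat where N: "real N * \<gamma> > - 2 * \<eta>"
      using reals_Archimedean3 by blast
    have "\<gamma> * (real T + 1) / 2 + \<eta> \<ge> 0" if "T \<ge> N" for T
    proof -
      have "\<gamma> * real N \<le> \<gamma> * (real T + 1)"
        using that True by (intro mult_left_mono) auto
      then show ?thesis using N by (simp add: mult.commute)
    qed
    then show ?thesis
      using eventually_sequentially by blast
  qed (use pos in auto)
  then have "eventually (\<lambda>T. ereal (- C / real T) \<le> ereal (1 / real T * (\<Sum>t=1..T. x t))) sequentially"
    using eventually_gt_at_top[of 0]
  proof eventually_elim
    case (elim T)
    have "(\<Sum>t=1..T. x t) = (\<Sum>k<T. x (T - k))"
      using sum.nat_diff_reindex[of "\<lambda>k. x (Suc k)" T]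
      by (simp add: Suc_diff_Suc sum.atLeast1_atMost_eq)
    moreover have "real T * (\<gamma> * (real T + 1) / 2 + \<eta>) \<ge> 0"
      using elim by simp
    ultimately have "- C \<le> (\<Sum>t=1..T. x t)"
      using C[of T T] affine[of T] by (simp add: abs_le_iff)
    then show ?case
      using elim(2) by (simp add: divide_right_mono[of "- C", simplified])
  qed
  then have "liminf (\<lambda>T. ereal (- C / real T)) \<le> liminf (\<lambda>T. ereal (1 / real T * (\<Sum>t=1..T. x t)))"
    by (rule Liminf_mono)
  moreover have "(\<lambda>T. ereal (- C / real T)) \<longlonglongrightarrow> 0"
    using lim_const_over_n[of "- C"] by (simp add: zero_ereal_def)
  then have "liminf (\<lambda>T. ereal (- C / real T)) = 0"
    by (intro lim_imp_Liminf) auto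
  ultimately show ?thesis by simp
qed

section \<open>Linear maps with bounded orbits\<close>

lemma linear_funpow:
  fixes f :: "'v::real_vector \<Rightarrow> 'v"
  shows "linear f \<Longrightarrow> linear (f ^^ n)"
  by (induction n) (auto simp: linear_id[unfolded id_def] id_def intro: linear_compose)

text \<open>With \<open>d = I - f\<close>, bounded orbits make kernel and range of \<open>d\<close>
  meet only in 0. So \<open>d\<close> is injective on its range and, by dimension, maps it onto
  itself, which gives the splitting.\<close>

lemma ergodic_decomposition:
  fixes f :: "'v::euclidean_space \<Rightarrow> 'v"
  assumes f: "linear f" and bdd: "\<And>x. bounded (range (\<lambda>n. (f ^^ n) x))"
  shows "\<exists>g h k. f g = g \<and> x = g + (h - f h) \<and> h = k - f k"
proof -
  define d where "d y = y - f y" for y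
  have d: "linear d"
    unfolding d_def using f by (intro linear_compose_sub linear_ident)
  \<comment> \<open>If \<open>d y\<close> is fixed by \<open>f\<close>, then \<open>n\<close> times
    \<open>d y\<close> telescopes to \<open>y - f^n y\<close>, which stays bounded only for
    \<open>d y = 0\<close>.\<close>
  have inter: "d y = 0" if "d (d y) = 0" for y
  proof (rule ccontr)
    assume nz: "d y \<noteq> 0"
    have fix1: "(f ^^ n) (d y) = d y" for n
      using that by (induction n) (auto simp: d_def)
    have grow: "real n *\<^sub>R d y = y - (f ^^ n) y" for n
    proof (induction n)
      case (Suc n)
      have "(f ^^ n) y - (f ^^ Suc n) y = (f ^^ n) (d y)"
        using linear_diff[OF linear_funpow[OF f], of n y "f y"] by (simp add: d_def funpow_swap1)
      then have step: "d y = (f ^^ n) y - (f ^^ Suc n) y"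
        by (simp only: fix1)
      have "real (Suc n) *\<^sub>R d y = real n *\<^sub>R d y + d y"
        by (simp add: scaleR_add_left)
      also have "\<dots> = (y - (f ^^ n) y) + ((f ^^ n) y - (f ^^ Suc n) y)"
        by (rule arg_cong2[OF Suc step])
      finally show ?case by simp
    qed simp
    obtain B where B: "\<And>n. norm ((f ^^ n) y) \<le> B"
      using bdd[of y] by (auto simp: bounded_iff)
    obtain n :: nat where "real n * norm (d y) > norm y + B"
      using reals_Archimedean3[of "norm (d y)"] nz by auto
    moreover have "real n * norm (d y) \<le> norm y + B"
      using grow[of n] B[of n] norm_triangle_ineq4[of y "(f ^^ n) y"]
      by (metis abs_of_nat add_left_mono norm_scaleR order_trans)
    ultimately show False by simp
  qed
  have sub: "subspace (range d)"
    using linear_subspace_image[OF d subspace_UNIV] .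
  have "inj_on d (range d)"
  proof (rule inj_onI)
    fix a b assume "a \<in> range d" "b \<in> range d" "d a = d b"
    then obtain a' b' where "a = d a'" "b = d b'" by auto
    then have "d (d (a' - b')) = 0"
      using \<open>d a = d b\<close> by (simp add: linear_diff[OF d])
    then show "a = b"
      using inter \<open>a = d a'\<close> \<open>b = d b'\<close> by (metis d eq_iff_diff_eq_0 linear_diff)
  qed
  then have "inj_on d (span (range d))"
    by (simp add: span_eq_iff[THEN iffD2, OF sub])
  then have "dim (d ` range d) = dim (range d)"
    by (rule dim_image_eq[OF d])
  then have surj: "d ` range d = range d"
    by (intro subspace_dim_equal linear_subspace_image[OF d] sub) auto
  have split: "\<exists>g h. d g = 0 \<and> y = g + d h" for y
  proof -
    have "d y \<in> d ` range d" using surj by simp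
    then obtain h where "d y = d (d h)" by auto
    then show ?thesis
      by (intro exI[of _ "y - d h"] exI[of _ h]) (simp add: linear_diff[OF d])
  qed
  obtain g h where g: "d g = 0" "x = g + d h" using split by blast
  \<comment> \<open>Splitting \<open>h\<close> again removes its fixed part: \<open>d k\<close> has
    the same image under \<open>d\<close> and can replace \<open>h\<close>. This normalization
    singles out the bias.\<close>
  obtain g' k where "d g' = 0" "h = g' + d k" using split by blast
  then have "d h = d (d k)" by (simp add: linear_add[OF d])
  with g show ?thesis
    by (intro exI[of _ g] exI[of _ "d k"] exI[of _ k]) (auto simp: d_def)
qed

lemma partial_sums_orbit_affine:
  fixes f :: "real^'s \<Rightarrow> real^'s"
  assumes f: "linear f" and bdd: "\<And>x. bounded (range (\<lambda>n. (f ^^ n) x))"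
  shows "\<exists>\<gamma> \<eta>. asymptotically_affine \<gamma> \<eta> (partial_sum (\<lambda>n. (f ^^ n) x $ s))"
proof -
  obtain g h k where g: "f g = g" and x: "x = g + (h - f h)" and h: "h = k - f k"
    using ergodic_decomposition[OF assms] by blast
  have fg: "(f ^^ n) g = g" for n
    using g by (induction n) auto
  have tele: "(f ^^ n) (y - f y) = (f ^^ n) y - (f ^^ Suc n) y" for n y
    using linear_diff[OF linear_funpow[OF f], of n y "f y"] by (simp add: funpow_swap1)
  have orbit: "(f ^^ n) x $ s = g $ s + (f ^^ n) h $ s - (f ^^ Suc n) h $ s" for n
    unfolding x linear_add[OF linear_funpow[OF f]] fg tele by simp
  have ps: "partial_sum (\<lambda>n. (f ^^ n) x $ s) n = g $ s * real n + h $ s - (f ^^ n) h $ s" for n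
  proof (induction n)
    case (Suc n)
    have "partial_sum (\<lambda>n. (f ^^ n) x $ s) (Suc n) =
        partial_sum (\<lambda>n. (f ^^ n) x $ s) n + (f ^^ n) x $ s"
      by (simp add: partial_sum_def)
    also have "\<dots> = g $ s * real (Suc n) + h $ s - (f ^^ Suc n) h $ s"
      unfolding Suc orbit[of n] of_nat_Suc distrib_left by linarith
    finally show ?case .
  qed (simp add: partial_sum_def)
  obtain B where B: "\<And>n. norm ((f ^^ n) k) \<le> B"
    using bdd[of k] by (auto simp: bounded_iff)
  have B: "\<bar>(f ^^ n) k $ s\<bar> \<le> B" for n
    by (rule order_trans[OF component_le_norm_cart B])
  \<comment> \<open>Because \<open>h = k - f k\<close>, the window telescopes to two orbit points of
    \<open>k\<close>, whatever its length; hence the bound \<open>2 * B\<close>.\<close>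
  have window: "(\<Sum>i<m. (f ^^ (n - i)) h $ s) = (f ^^ (Suc n - m)) k $ s - (f ^^ Suc n) k $ s"
    if "m \<le> Suc n" for n m
    using that
  proof (induction m)
    case (Suc m)
    then have "Suc n - m = Suc (n - m)" by simp
    moreover have "(f ^^ (n - m)) h = (f ^^ (n - m)) k - (f ^^ Suc (n - m)) k"
      unfolding h by (rule tele)
    ultimately show ?case using Suc by simp
  qed simp
  have "windows_bounded (\<lambda>n. - ((f ^^ n) h $ s))"
    unfolding windows_bounded_def
  proof (intro exI allI impI)
    fix n m :: nat assume m: "m \<le> Suc n"
    show "\<bar>\<Sum>i<m. - ((f ^^ (n - i)) h $ s)\<bar> \<le> 2 * B"
      using window[OF m] B[of "Suc n - m"] B[of "Suc n"] by (simp add: sum_negf)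
  qed
  then have "asymptotically_affine (g $ s) (h $ s) (partial_sum (\<lambda>n. (f ^^ n) x $ s))"
    by (simp add: asymptotically_affine_def ps)
  then show ?thesis by blast
qed

section \<open>Stationary reward streams\<close>

lemma reward_stream_stationary:
  "reward_stream p r s (\<lambda>_. f) = (\<lambda>t. ((*v) (Q_mat p f) ^^ t) (r_vec r f) $ s)"
proof -
  have "Q_prod p (\<lambda>_. f) t *v x = ((*v) (Q_mat p f) ^^ t) x" for t x
    by (induction t arbitrary: x)
      (auto simp: matrix_vector_mul_assoc[symmetric] funpow_swap1)
  then show ?thesis by (simp add: reward_stream_def)
qed

text \<open>Each row is a probability distribution, so the product averages the entries of
  \<open>x\<close>. Iterating this in the maximum norm bounds all orbits.\<close>

lemma Q_mat_contraction:
  assumes "\<And>i. \<bar>x $ i\<bar> \<le> B"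
  shows "\<bar>(Q_mat p f *v x) $ i\<bar> \<le> B"
proof -
  have "\<bar>(Q_mat p f *v x) $ i\<bar> \<le> (\<Sum>j\<in>UNIV. \<bar>pmf (p (f i) i) j * x $ j\<bar>)"
    by (simp add: Q_mat_def matrix_vector_mult_def sum_abs)
  also have "\<dots> \<le> (\<Sum>j\<in>UNIV. pmf (p (f i) i) j * B)"
    using assms by (intro sum_mono) (simp add: abs_mult mult_left_mono)
  also have "\<dots> = B"
    by (simp add: sum_distrib_right[symmetric] sum_pmf_eq_1)
  finally show ?thesis .
qed

lemma Q_mat_orbit_bounded:
  fixes x :: "real^'s"
  shows "bounded (range (\<lambda>n. ((*v) (Q_mat p f) ^^ n) x))"
proof -
  have comp: "\<bar>((*v) (Q_mat p f) ^^ n) x $ i\<bar> \<le> norm x" for n i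
    by (induction n arbitrary: i) (auto simp: component_le_norm_cart Q_mat_contraction)
  have "norm (((*v) (Q_mat p f) ^^ n) x) \<le> (\<Sum>i\<in>(UNIV :: 's set). norm x)" for n
  proof -
    have "norm (((*v) (Q_mat p f) ^^ n) x) \<le> (\<Sum>i\<in>UNIV. \<bar>((*v) (Q_mat p f) ^^ n) x $ i\<bar>)"
      by (rule norm_le_l1_cart)
    also have "\<dots> \<le> (\<Sum>i\<in>(UNIV :: 's set). norm x)"
      by (intro sum_mono comp)
    finally show ?thesis .
  qed
  then show ?thesis by (auto simp: bounded_iff)
qed

lemma reward_stream_bounded: "reward_stream p r s (\<lambda>_. f) \<in> bounded_streams"
proof -
  obtain B where "\<And>n. norm (((*v) (Q_mat p f) ^^ n) (r_vec r f)) \<le> B"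
    using Q_mat_orbit_bounded[of p f "r_vec r f"] by (auto simp: bounded_iff)
  then show ?thesis
    unfolding reward_stream_stationary
    by (intro bounded_streamsI[of _ B]) (meson component_le_norm_cart order_trans)
qed

lemma reward_stream_affine:
  "\<exists>\<gamma> \<eta>. asymptotically_affine \<gamma> \<eta> (partial_sum (reward_stream p r s (\<lambda>_. f)))"
  unfolding reward_stream_stationary
  by (intro partial_sums_orbit_affine matrix_vector_mul_linear Q_mat_orbit_bounded)

lemma (in stream_preference) R_stationary_imp_avg_overtaking:
  assumes "R (reward_stream p r s (\<lambda>_. f)) (reward_stream p r s (\<lambda>_. g))"
  shows "avg_overtaking (reward_stream p r s (\<lambda>_. f)) (reward_stream p r s (\<lambda>_. g))"
    (is "avg_overtaking ?u ?v")
proof -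
  let ?w = "\<lambda>t. ?u t - ?v t"
  obtain a b c d where u: "asymptotically_affine a b (partial_sum ?u)"
    and v: "asymptotically_affine c d (partial_sum ?v)"
    using reward_stream_affine[of p r s f] reward_stream_affine[of p r s g] by blast
  have "partial_sum ?w = (\<lambda>n. partial_sum ?u n - partial_sum ?v n)"
    by (simp add: partial_sum_def sum_subtractf fun_eq_iff)
  with asymptotically_affine_diff[OF u v]
  have aff: "asymptotically_affine (a - c) (b - d) (partial_sum ?w)"
    by (simp only:)
  have "weakly_good ?w"
    using assms by (intro R_imp_weakly_good reward_stream_bounded)
  from liminf_averages_nonneg[OF aff weakly_good_affine_limit[OF this aff]]
  show ?thesis by (simp add: avg_overtaking_def)
qed

theorem theorem1:
  fixes p :: "'a::finite \<Rightarrow> 's::finite \<Rightarrow> 's pmf"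
    and r :: "'s \<times> 'a \<Rightarrow> real"
    and R :: pref
    and \<pi>' :: "('s, 'a) policy"
  assumes "preorder_on_streams R"
    and "axiom_A1 R"
    and "axiom_A2 R"
    and "axiom_A3 R"
    and "axiom_A4 R"
    and "axiom_A5 R"
    and "stationary_optimal R p r \<pi>'"
  shows "stationary_optimal avg_overtaking p r \<pi>'"
proof -
  interpret stream_preference R
    using assms by unfold_locales
  show ?thesis
    using assms(7) R_stationary_imp_avg_overtaking
    by (fastforce simp: stationary_optimal_def stationary_policies_def)
qed

end
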